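(* Let $G$ be a nonempty graph with $\gamma_{\rm R}(G)\ge 3$. Then $b_{\rm R}(G)\le(\gamma_{\rm R}(G)-2)\Delta(G)+1$.
   Context: Graphs are finite, undirected, without loops or multiple edges; a graph is nonempty if it has at least one edge; $\Delta(G)$ is the maximum degree of $G$. A Roman dominating function on $G=(V,E)$ is a function $f:V\to\{0,1,2\}$ such that every vertex $x$ with $f(x)=0$ is adjacent to at least one vertex $y$ with $f(y)=2$. Its weight is $\sum_{u\in V}f(u)$. The Roman domination number $\gamma_{\rm R}(G)$ is the minimum weight of a Roman dominating function on $G$. The Roman bondage number of a nonempty graph $G$ is $b_{\rm R}(G)=\min\{|B|: B\subseteq E(G),\ \gamma_{\rm R}(G-B)>\gamma_{\rm R}(G)\}$, with $b_{\rm R}(G)=\infty$ if no such $B$ exists; here $G-B$ is obtained from $G$ by deleting the edges in $B$ (keeping all vertices).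
   Formalization: The formal theorem also assumes Δ(G) ≥ 2: when Δ(G) = 1 every component is K1 or K2, so γ_R(G) = |V| cannot increase and b_R(G) = ∞, and the stated bound fails (e.g. K2 together with an isolated vertex). *)

theory Defs
  imports "HOL-Library.Extended_Nat"
begin

definition simple_graph :: "'a set \<Rightarrow> 'a set set \<Rightarrow> bool" where
  "simple_graph V E \<longleftrightarrow> finite V \<and> (\<forall>e\<in>E. e \<subseteq> V \<and> card e = 2)"

definition degree :: "'a set set \<Rightarrow> 'a \<Rightarrow> nat" where
  "degree E x = card {e \<in> E. x \<in> e}"

(* Meaningful only for V nonempty, since Max {} is unspecified. *)
definition max_degree :: "'a set \<Rightarrow> 'a set set \<Rightarrow> nat" where
  "max_degree V E = Max (degree E ` V)"

(* Only the values of f on V matter. *)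
definition roman_dominating :: "'a set \<Rightarrow> 'a set set \<Rightarrow> ('a \<Rightarrow> nat) \<Rightarrow> bool" where
  "roman_dominating V E f \<longleftrightarrow>
     (\<forall>x\<in>V. f x \<in> {0, 1, 2}) \<and>
     (\<forall>x\<in>V. f x = 0 \<longrightarrow> (\<exists>y\<in>V. {x, y} \<in> E \<and> f y = 2))"

(* The set of weights is never empty (take f constantly 1), so this infimum of
   natural numbers is attained. *)
definition roman_domination_number :: "'a set \<Rightarrow> 'a set set \<Rightarrow> nat" where
  "roman_domination_number V E = Inf {\<Sum>u\<in>V. f u | f. roman_dominating V E f}"

(* In enat the infimum of a nonempty set is its minimum and Inf {} = \<infinity>,
   which is the convention for graphs in which no such B exists.
   If a simple graph has maximum degree 1, then its Roman domination number is
   card V and cannot be increased by deleting edges, so the value is \<infinity>;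
   finite upper bounds therefore need maximum degree at least 2. *)
definition roman_bondage_number :: "'a set \<Rightarrow> 'a set set \<Rightarrow> enat" where
  "roman_bondage_number V E =
     Inf {enat (card B) | B. B \<subseteq> E \<and>
       roman_domination_number V (E - B) > roman_domination_number V E}"

end

theory Submission
  imports Defs
begin

text \<open>
  Write \<open>k\<close> for the Roman domination number, \<open>n\<close> for the number of vertices and \<open>\<Delta>\<close> for the
  maximum degree. Giving the value 2 to a vertex \<open>v\<close>, 0 to its neighbours and 1 to all
  other vertices shows \<open>k + deg v \<le> n + 1\<close> (lemma \<open>star_bound\<close>). This bound is what makes the
  argument work: put aside an arbitrary set \<open>X\<close> of \<open>k - 3\<close> vertices. The set \<open>W\<close> of the
  remaining \<open>m = n - k + 3\<close> vertices then satisfies \<open>\<Delta> \<le> m - 2\<close>, so every degree is at most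
  \<open>m - 2\<close>, and \<open>m \<ge> 4\<close> because \<open>\<Delta> \<ge> 2\<close>.

  Delete all edges that meet \<open>X\<close>; there are at most \<open>(k - 3) \<Delta>\<close> of them. Every vertex of
  \<open>X\<close> becomes isolated and must receive a positive value, so the weight on \<open>X\<close> is at least
  \<open>k - 3\<close>. It remains to force weight 4 on \<open>W\<close> by deleting at most \<open>\<Delta> + 1\<close> further edges.
  Weight 4 is forced once all degrees inside \<open>W\<close> are at most \<open>m - 3\<close>
  (lemma \<open>weight_ge_4\<close>). If this fails, some vertex \<open>w\<close> has degree \<open>m - 2\<close> inside \<open>W\<close>; its
  star together with one edge at its only non-neighbour meets every non-isolated vertex of
  \<open>W\<close>, so deleting these edges lowers every positive degree by at least one
  (lemma \<open>few_edges_lower_degrees\<close>). All deletions together number at most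
  \<open>(k - 3) \<Delta> + \<Delta> + 1 = (k - 2) \<Delta> + 1\<close>.
\<close>

section \<open>The Roman domination number as a minimum\<close>

lemma roman_domination_number_le:
  assumes "roman_dominating V E f"
  shows "roman_domination_number V E \<le> (\<Sum>u\<in>V. f u)"
  unfolding roman_domination_number_def
  by (rule cInf_lower) (use assms in auto)

lemma roman_domination_number_ge:
  assumes "\<And>f. roman_dominating V E f \<Longrightarrow> c \<le> (\<Sum>u\<in>V. f u)"
  shows "c \<le> roman_domination_number V E"
proof -
  have "roman_dominating V E (\<lambda>_. 1)"
    by (simp add: roman_dominating_def)
  then show ?thesis
    unfolding roman_domination_number_def
    by (intro cInf_greatest) (use assms in blast)+
qed

section \<open>Degrees and neighbourhoods\<close>

lemma simple_graph_finite_edges: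
  assumes "simple_graph V E"
  shows "finite E"
proof (rule finite_subset)
  show "E \<subseteq> Pow V" "finite (Pow V)"
    using assms by (auto simp: simple_graph_def)
qed

lemma degree_pos_obtains_edge:
  assumes "degree E x > 0"
  obtains e where "e \<in> E" "x \<in> e"
proof -
  have "{e \<in> E. x \<in> e} \<noteq> {}"
    using assms unfolding degree_def by (metis card.empty less_irrefl)
  then show ?thesis using that by blast
qed

lemma card_neighbours:
  assumes "simple_graph V E"
  shows "card {y. {x, y} \<in> E} = degree E x"
proof -
  have two: "card e = 2" if "e \<in> E" for e
    using assms that by (auto simp: simple_graph_def)
  have "inj_on (\<lambda>y. {x, y}) {y. {x, y} \<in> E}"
    by (auto simp: inj_on_def doubleton_eq_iff)
  moreover have "(\<lambda>y. {x, y}) ` {y. {x, y} \<in> E} = {e \<in> E. x \<in> e}"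
  proof
    show "{e \<in> E. x \<in> e} \<subseteq> (\<lambda>y. {x, y}) ` {y. {x, y} \<in> E}"
    proof
      fix e assume e: "e \<in> {e \<in> E. x \<in> e}"
      then obtain y where "e = {x, y}"
        using two[of e] by (auto simp: card_2_iff)
      with e show "e \<in> (\<lambda>y. {x, y}) ` {y. {x, y} \<in> E}" by auto
    qed
  qed auto
  ultimately show ?thesis
    unfolding degree_def using card_image by fastforce
qed

lemma neighbours_subset:
  assumes "simple_graph V E"
  shows "{y. {x, y} \<in> E} \<subseteq> V - {x}"
proof
  fix y assume "y \<in> {y. {x, y} \<in> E}"
  then have "{x, y} \<subseteq> V" "card {x, y} = 2"
    using assms by (auto simp: simple_graph_def)
  then show "y \<in> V - {x}" by (auto split: if_splits)
qed

section \<open>Weights and degrees\<close>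

text \<open>
  The function with value 2 at \<open>v\<close>, 0 on its neighbours and 1 elsewhere is Roman dominating
  and has weight \<open>2 + (card V - 1 - degree E v)\<close>.
\<close>

lemma star_bound:
  assumes G: "simple_graph V E" and v: "v \<in> V"
  shows "roman_domination_number V E + degree E v \<le> card V + 1"
proof -
  let ?N = "{y. {v, y} \<in> E}"
  let ?f = "\<lambda>u. if u = v then 2 else if u \<in> ?N then 0 else (1::nat)"
  have fin: "finite V" using G by (simp add: simple_graph_def)
  have N: "?N \<subseteq> V - {v}" by (rule neighbours_subset[OF G])
  have "roman_dominating V E ?f"
    using v by (auto simp: roman_dominating_def insert_commute)
  then have "roman_domination_number V E \<le> (\<Sum>u\<in>V. ?f u)"
    by (rule roman_domination_number_le)
  also have "\<dots> = 2 + (\<Sum>u\<in>V - {v}. ?f u)"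
    using fin v by (simp add: sum.remove)
  also have "(\<Sum>u\<in>V - {v}. ?f u) = (\<Sum>u\<in>V - {v} - ?N. 1)"
    using fin by (intro sum.mono_neutral_cong_right) auto
  also have "\<dots> = card V - 1 - degree E v"
    using N fin v card_neighbours[OF G, of v]
    by (simp add: card_Diff_subset finite_subset)
  finally have "roman_domination_number V E \<le> 2 + (card V - 1 - degree E v)" .
  moreover have "degree E v \<le> card V - 1"
    using card_mono[OF _ N] fin v card_neighbours[OF G, of v] by simp
  moreover have "card V \<ge> 1"
    using fin v by (metis One_nat_def Suc_leI card_gt_0_iff empty_iff)
  ultimately show ?thesis by linarith
qed

text \<open>
  Two vertices of value 2 already weigh 4, and without a vertex of value 2 all values are
  positive. A single vertex of value 2 dominates at most \<open>card W - 3\<close> others, which leaves at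
  least two further vertices of positive value.
\<close>

lemma weight_ge_4:
  assumes G: "simple_graph W H" and m: "card W \<ge> 4"
    and deg: "\<And>x. x \<in> W \<Longrightarrow> degree H x + 3 \<le> card W"
    and f: "roman_dominating W H f"
  shows "4 \<le> (\<Sum>u\<in>W. f u)"
proof (cases "\<exists>y\<in>W. f y = 2")
  case False
  have "1 \<le> f u" if "u \<in> W" for u
  proof -
    have "f u \<noteq> 0" using False f that unfolding roman_dominating_def by blast
    then show ?thesis by simp
  qed
  then have "(\<Sum>u\<in>W. 1) \<le> (\<Sum>u\<in>W. f u)" by (rule sum_mono)
  with m show ?thesis by simp
next
  case True
  then obtain y where y: "y \<in> W" "f y = 2" by blast
  have fin: "finite W" using G by (simp add: simple_graph_def)
  have split_y: "(\<Sum>u\<in>W. f u) = 2 + (\<Sum>u\<in>W - {y}. f u)"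
    using fin y by (simp add: sum.remove)
  show ?thesis
  proof (cases "\<exists>z\<in>W - {y}. f z = 2")
    case True
    then obtain z where "z \<in> W - {y}" "f z = 2" by blast
    then have "2 \<le> (\<Sum>u\<in>W - {y}. f u)"
      using fin member_le_sum[of z "W - {y}" f] by simp
    with split_y show ?thesis by simp
  next
    case False
    let ?N = "{z. {y, z} \<in> H}"
    have pos: "1 \<le> f u" if u: "u \<in> W - {y} - ?N" for u
    proof (rule ccontr)
      assume "\<not> 1 \<le> f u"
      then have "f u = 0" by simp
      then obtain z where "z \<in> W" "{u, z} \<in> H" "f z = 2"
        using f u unfolding roman_dominating_def by blast
      with False u show False by (auto simp: insert_commute)
    qed
    have N: "?N \<subseteq> W - {y}" by (rule neighbours_subset[OF G])
    have "card (W - {y} - ?N) = card W - 1 - degree H y"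
      using N fin y card_neighbours[OF G, of y]
      by (simp add: card_Diff_subset finite_subset)
    then have "2 \<le> (\<Sum>u\<in>W - {y} - ?N. 1::nat)"
      using deg[OF y(1)] by simp
    also have "\<dots> \<le> (\<Sum>u\<in>W - {y} - ?N. f u)"
      using pos by (rule sum_mono)
    also have "\<dots> \<le> (\<Sum>u\<in>W - {y}. f u)"
      using fin by (intro sum_mono2) auto
    finally show ?thesis using split_y by simp
  qed
qed

section \<open>Lowering the degrees by deleting few edges\<close>

text \<open>
  A vertex \<open>w\<close> of degree \<open>card W - 2\<close> has exactly one non-neighbour \<open>w'\<close> besides itself. Hence
  the edges at \<open>w\<close> meet all of \<open>W\<close> except \<open>w'\<close>, and one more edge takes care of \<open>w'\<close> unless
  it is isolated.
\<close>

lemma few_edges_lower_degrees: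
  assumes G: "simple_graph W H" and m: "card W \<ge> 3"
    and deg: "\<And>x. x \<in> W \<Longrightarrow> degree H x + 2 \<le> card W"
    and D: "\<And>x. x \<in> W \<Longrightarrow> degree H x \<le> D"
  obtains C where "C \<subseteq> H" "card C \<le> D + 1"
    "\<And>x. x \<in> W \<Longrightarrow> degree (H - C) x + 3 \<le> card W"
proof (cases "\<forall>x\<in>W. degree H x + 3 \<le> card W")
  case True
  with that[of "{}"] show ?thesis by simp
next
  case False
  then obtain w where w: "w \<in> W" and dw: "degree H w + 2 = card W"
    using deg by (metis add_Suc_right eval_nat_numeral(3) le_antisym not_less_eq_eq)
  have fin: "finite W" "finite H"
    using G simple_graph_finite_edges by (auto simp: simple_graph_def)
  let ?N = "{y. {w, y} \<in> H}"
  have N: "?N \<subseteq> W - {w}" by (rule neighbours_subset[OF G])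
  have "card (W - {w} - ?N) = card W - 1 - degree H w"
    using N fin w card_neighbours[OF G, of w]
    by (simp add: card_Diff_subset finite_subset)
  also have "\<dots> = 1" using dw by simp
  finally obtain w' where w': "W - {w} - ?N = {w'}"
    by (auto simp: card_1_singleton_iff)
  \<comment> \<open>If \<open>w'\<close> is isolated, \<open>e\<close> is only a dummy, chosen among the edges at \<open>w\<close>.\<close>
  obtain e where e: "e \<in> H" "degree H w' > 0 \<Longrightarrow> w' \<in> e"
  proof (cases "degree H w' > 0")
    case True
    then obtain e where "e \<in> H" "w' \<in> e" by (rule degree_pos_obtains_edge)
    then show ?thesis by (rule that)
  next
    case False
    have "degree H w > 0" using dw m by simp
    then obtain e where "e \<in> H" by (rule degree_pos_obtains_edge)
    then show ?thesis by (rule that) (simp add: False)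
  qed
  let ?C = "insert e {e \<in> H. w \<in> e}"
  have covered: "\<exists>c\<in>?C. x \<in> c" if x: "x \<in> W" and d: "degree H x > 0" for x
  proof -
    consider "x = w" | "x = w'" | "{w, x} \<in> H" using x w' by blast
    then show ?thesis
    proof cases
      case 1
      obtain c where "c \<in> H" "x \<in> c" using d by (rule degree_pos_obtains_edge)
      then show ?thesis using 1 by blast
    next
      case 2
      then show ?thesis using e d by blast
    next
      case 3
      then show ?thesis by blast
    qed
  qed
  have CH: "?C \<subseteq> H" using e by blast
  show ?thesis
  proof (rule that[OF CH])
    have "card ?C \<le> Suc (degree H w)"
      unfolding degree_def by (rule card_insert_le_m1) auto
    then show "card ?C \<le> D + 1" using D[OF w] by simp
  next
    fix x assume x: "x \<in> W"
    show "degree (H - ?C) x + 3 \<le> card W"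
    proof (cases "degree H x > 0")
      case True
      then obtain c where "c \<in> ?C" "x \<in> c" using covered x by blast
      then have "{e \<in> H - ?C. x \<in> e} \<subset> {e \<in> H. x \<in> e}" using CH by blast
      then have "degree (H - ?C) x < degree H x"
        unfolding degree_def using fin by (intro psubset_card_mono) auto
      with deg[OF x] show ?thesis by simp
    next
      case False
      have "degree (H - ?C) x \<le> degree H x"
        unfolding degree_def using fin by (intro card_mono) auto
      with False m show ?thesis by simp
    qed
  qed
qed

section \<open>The bound on the Roman bondage number\<close>

theorem theorem5p5:
  fixes V :: "'a set" and E :: "'a set set"
  assumes "simple_graph V E"
    and "E \<noteq> {}"
    and "max_degree V E \<ge> 2"
    and "roman_domination_number V E \<ge> 3"
  shows "roman_bondage_number V E
           \<le> enat ((roman_domination_number V E - 2) * max_degree V E + 1)"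
proof -
  let ?k = "roman_domination_number V E" and ?D = "max_degree V E"
  note G = assms(1)
  have fin: "finite V" "finite E"
    using G simple_graph_finite_edges by (auto simp: simple_graph_def)
  have "V \<noteq> {}"
    using assms(1,2) by (force simp: simple_graph_def)
  then have "?D \<in> degree E ` V"
    unfolding max_degree_def using fin by (intro Max_in) auto
  then obtain v where v: "v \<in> V" "degree E v = ?D" by (metis imageE)
  have D: "degree E x \<le> ?D" if "x \<in> V" for x
    unfolding max_degree_def using fin that by (intro Max_ge) auto
  have kn: "?k + ?D \<le> card V + 1"
    using star_bound[OF G v(1)] v(2) by simp
  obtain X where X: "X \<subseteq> V" "card X = ?k - 3"
  proof -
    have "?k - 3 \<le> card V" using kn assms(3) by linarith
    then show ?thesis using obtain_subset_with_card_n that by metis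
  qed
  have finX: "finite X" using X fin finite_subset by blast
  define W where "W = V - X"
  define H where "H = {e \<in> E. e \<subseteq> W}"
  define B where "B = {e \<in> E. \<not> e \<subseteq> W}"
  have W: "card W = card V - (?k - 3)"
    unfolding W_def using X finX by (simp add: card_Diff_subset)
  then have m: "card W \<ge> 4" "?D + 2 \<le> card W"
    using kn assms(3,4) by linarith+
  have GH: "simple_graph W H"
    using G by (auto simp: simple_graph_def W_def H_def)
  have DH: "degree H x \<le> ?D" if "x \<in> W" for x
  proof -
    have "degree H x \<le> degree E x"
      unfolding degree_def using fin by (intro card_mono) (auto simp: H_def)
    with D[of x] that show ?thesis by (simp add: W_def)
  qed
  obtain C where C: "C \<subseteq> H" "card C \<le> ?D + 1"
    "\<And>x. x \<in> W \<Longrightarrow> degree (H - C) x + 3 \<le> card W"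
  proof (rule few_edges_lower_degrees[OF GH])
    show "3 \<le> card W" using m by simp
    show "degree H x + 2 \<le> card W" if "x \<in> W" for x
      using DH[OF that] m by simp
  qed (use DH in auto)
  have "B \<subseteq> (\<Union>x\<in>X. {e \<in> E. x \<in> e})"
    using G by (auto simp: B_def W_def simple_graph_def)
  then have "card B \<le> card (\<Union>x\<in>X. {e \<in> E. x \<in> e})"
    using fin finX by (intro card_mono) auto
  also have "\<dots> \<le> (\<Sum>x\<in>X. degree E x)"
    unfolding degree_def by (rule card_UN_le[OF finX])
  also have "\<dots> \<le> card X * ?D"
    using sum_bounded_above[of X "degree E" ?D] D X by auto
  finally have "card B \<le> (?k - 3) * ?D" using X by simp
  moreover have "card (B \<union> C) \<le> card B + card C" by (rule card_Un_le)
  moreover have "?k - 2 = Suc (?k - 3)" using assms(4) by simp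
  ultimately have card_BC: "card (B \<union> C) \<le> (?k - 2) * ?D + 1"
    using C(2) by simp
  \<comment> \<open>What survives lives inside \<open>W\<close>, so weights on \<open>W\<close> and on \<open>X\<close> can be bounded separately.\<close>
  have EBC: "E - (B \<union> C) = H - C" by (auto simp: B_def H_def)
  have GHC: "simple_graph W (H - C)" using GH by (simp add: simple_graph_def)
  have "?k + 1 \<le> roman_domination_number V (E - (B \<union> C))"
    unfolding EBC
  proof (rule roman_domination_number_ge)
    fix f assume f: "roman_dominating V (H - C) f"
    have inW: "x \<in> W \<and> y \<in> W" if "{x, y} \<in> H" for x y
      using that by (auto simp: H_def)
    have "roman_dominating W (H - C) f"
      using f inW unfolding roman_dominating_def W_def by blast
    then have "4 \<le> (\<Sum>u\<in>W. f u)"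
      using weight_ge_4[OF GHC m(1)] C(3) by blast
    moreover have "1 \<le> f x" if x: "x \<in> X" for x
    proof (rule ccontr)
      assume "\<not> 1 \<le> f x"
      then have "f x = 0" by simp
      then obtain y where "{x, y} \<in> H"
        using f x X unfolding roman_dominating_def by blast
      with inW x show False by (auto simp: W_def)
    qed
    then have "(\<Sum>x\<in>X. 1) \<le> (\<Sum>x\<in>X. f x)" by (rule sum_mono)
    moreover have "(\<Sum>u\<in>V. f u) = (\<Sum>u\<in>W. f u) + (\<Sum>u\<in>X. f u)"
      unfolding W_def using X fin by (simp add: sum.subset_diff)
    ultimately show "?k + 1 \<le> (\<Sum>u\<in>V. f u)"
      using X by simp
  qed
  then have "roman_bondage_number V E \<le> enat (card (B \<union> C))"
    unfolding roman_bondage_number_def using C(1)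
    by (intro Inf_lower) (auto simp: B_def H_def)
  also have "\<dots> \<le> enat ((?k - 2) * ?D + 1)" using card_BC by simp
  finally show ?thesis .
qed

end
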